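(* Let $E$ be a locally convex vector space whose topology is generated by an increasing sequence of seminorms $(p_n)_{n\in\mathbb N}$. Let $(A_n)_{n\in\mathbb N}$ be a decreasing chain of non-empty internal subsets of $\mathcal G_E$, i.e. $A_1\supseteq A_2\supseteq\cdots\supseteq A_n\supseteq\cdots$. Suppose also that there is a sequence of positive numbers $t_n$ such that $p_n(v)\le\alpha^{-t_n}$ for all $v\in A_n$ and all $n\in\mathbb N$. Then $\bigcap_{n\in\mathbb N}A_n\neq\emptyset$.
   Context: For a locally convex space $E$ with topology generated by seminorms $(p_i)_{i\in I}$: a net $(u_\varepsilon)_\varepsilon\in E^{(0,1)}$ is moderate if for each $i\in I$ there are $M\in\mathbb N$ and $\eta\in(0,1)$ with $p_i(u_\varepsilon)\le\varepsilon^{-M}$ for all $\varepsilon\le\eta$; it is negligible if for each $i\in I$ and each $m\in\mathbb N$ there is $\eta\in(0,1)$ with $p_i(u_\varepsilon)\le\varepsilon^m$ for all $\varepsilon\le\eta$. The Colombeau space based on $E$ is the quotient $\mathcal G_E$ of the moderate nets by the negligible nets; a net in the class $u\in\mathcal G_E$ is called a representative of $u$. $\widetilde{\mathbb R}=\mathcal G_{\mathbb R}$, ordered by: $x\le y$ iff there are representatives with $x_\varepsilon\le y_\varepsilon$ for all sufficiently small $\varepsilon$. Each $p_i$ induces a map $p_i:\mathcal G_E\to\widetilde{\mathbb R}$, $p_i([(u_\varepsilon)_\varepsilon])=[(p_i(u_\varepsilon))_\varepsilon]$. $\alpha\in\widetilde{\mathbb R}$ has representative $(\varepsilon)_\varepsilon$,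 and $\alpha^t=[(\varepsilon^t)_\varepsilon]$ for $t\in\mathbb R$. A subset $A\subseteq\mathcal G_E$ is internal if there is a net $(A_\varepsilon)_{\varepsilon\in(0,1)}$ of subsets of $E$ such that $A=[(A_\varepsilon)_\varepsilon]$, the set of all $u\in\mathcal G_E$ for which there exist a representative $(u_\varepsilon)_\varepsilon$ of $u$ and $\eta>0$ such that $u_\varepsilon\in A_\varepsilon$ for all $\varepsilon<\eta$. *)

theory Defs
  imports "HOL-Analysis.Analysis"
begin

text \<open>
  The spaces are real vector spaces. A complex locally convex space is covered through its
  underlying real space: complex seminorms are real seminorms, and neither the topology nor any
  of the notions below uses multiplication by non-real scalars.
\<close>

definition seminorm :: "('a::real_vector \<Rightarrow> real) \<Rightarrow> bool" where
  "seminorm q \<longleftrightarrow>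
     (\<forall>x y. q (x + y) \<le> q x + q y) \<and> (\<forall>c x. q (c *\<^sub>R x) = \<bar>c\<bar> * q x)"

text \<open>The space is the whole type, and the family need not separate points, so the topology
  need not be Hausdorff.\<close>

definition locally_convex_generated_by ::
    "'a::real_vector topology \<Rightarrow> ('i \<Rightarrow> 'a \<Rightarrow> real) \<Rightarrow> bool" where
  "locally_convex_generated_by E p \<longleftrightarrow>
     (\<forall>i. seminorm (p i)) \<and>
     E = topology_generated_by {{y. p i (y - x) < r} |i x r. 0 < r}"

text \<open>Nets in \<open>E\<^bsup>(0,1)\<^esup>\<close> are functions on the reals that are \<open>undefined\<close> off \<open>(0,1)\<close>.\<close>

abbreviation nets :: "(real \<Rightarrow> 'a) set" where
  "nets \<equiv> {0<..<1} \<rightarrow>\<^sub>E UNIV"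

definition moderate :: "('i \<Rightarrow> 'a \<Rightarrow> real) \<Rightarrow> (real \<Rightarrow> 'a) set" where
  "moderate p = {u \<in> nets. \<forall>i. \<exists>M::nat. \<exists>\<eta>\<in>{0<..<1}.
     \<forall>\<epsilon>\<in>{0<..\<eta>}. p i (u \<epsilon>) \<le> \<epsilon> powr (- real M)}"

definition negligible_nets :: "('i \<Rightarrow> 'a \<Rightarrow> real) \<Rightarrow> (real \<Rightarrow> 'a) set" where
  "negligible_nets p = {u \<in> nets. \<forall>i. \<forall>m::nat. \<exists>\<eta>\<in>{0<..<1}.
     \<forall>\<epsilon>\<in>{0<..\<eta>}. p i (u \<epsilon>) \<le> \<epsilon> ^ m}"

definition colombeau_rel ::
    "('i \<Rightarrow> 'a::real_vector \<Rightarrow> real) \<Rightarrow> ((real \<Rightarrow> 'a) \<times> (real \<Rightarrow> 'a)) set" where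
  "colombeau_rel p = {(u, v). u \<in> moderate p \<and> v \<in> moderate p \<and>
     (\<lambda>\<epsilon>\<in>{0<..<1}. u \<epsilon> - v \<epsilon>) \<in> negligible_nets p}"

text \<open>Elements of the quotient are classes of nets, so the representatives of \<open>U\<close> are exactly
  the members of \<open>U\<close>.\<close>

definition colombeau :: "('i \<Rightarrow> 'a::real_vector \<Rightarrow> real) \<Rightarrow> (real \<Rightarrow> 'a) set set" where
  "colombeau p = moderate p // colombeau_rel p"

definition colombeau_class ::
    "('i \<Rightarrow> 'a::real_vector \<Rightarrow> real) \<Rightarrow> (real \<Rightarrow> 'a) \<Rightarrow> (real \<Rightarrow> 'a) set" where
  "colombeau_class p u = colombeau_rel p `` {u}"

text \<open>Generalized real numbers: the Colombeau space of the reals with the single seminorm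
  \<open>\<bar>\<cdot>\<bar>\<close>.\<close>

abbreviation real_seminorms :: "unit \<Rightarrow> real \<Rightarrow> real" where
  "real_seminorms \<equiv> \<lambda>_ x. \<bar>x\<bar>"

abbreviation gen_reals :: "(real \<Rightarrow> real) set set" where
  "gen_reals \<equiv> colombeau real_seminorms"

abbreviation gen_real :: "(real \<Rightarrow> real) \<Rightarrow> (real \<Rightarrow> real) set" where
  "gen_real \<equiv> colombeau_class real_seminorms"

definition gen_real_le :: "(real \<Rightarrow> real) set \<Rightarrow> (real \<Rightarrow> real) set \<Rightarrow> bool"
    (infix "\<le>\<^sub>G" 50) where
  "X \<le>\<^sub>G Y \<longleftrightarrow>
     (\<exists>x\<in>X. \<exists>y\<in>Y. \<exists>\<eta>\<in>{0<..<1}. \<forall>\<epsilon>\<in>{0<..\<eta>}. x \<epsilon> \<le> y \<epsilon>)"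

definition alpha_powr :: "real \<Rightarrow> (real \<Rightarrow> real) set" where
  "alpha_powr t = gen_real (\<lambda>\<epsilon>\<in>{0<..<1}. \<epsilon> powr t)"

text \<open>The union runs over classes that all coincide; see \<open>induced_seminorm_class\<close> below.\<close>

definition induced_seminorm ::
    "('i \<Rightarrow> 'a \<Rightarrow> real) \<Rightarrow> 'i \<Rightarrow> (real \<Rightarrow> 'a) set \<Rightarrow> (real \<Rightarrow> real) set" where
  "induced_seminorm p i U = (\<Union>u\<in>U. gen_real (\<lambda>\<epsilon>\<in>{0<..<1}. p i (u \<epsilon>)))"

definition internal_set ::
    "('i \<Rightarrow> 'a::real_vector \<Rightarrow> real) \<Rightarrow> (real \<Rightarrow> 'a set) \<Rightarrow> (real \<Rightarrow> 'a) set set" where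
  "internal_set p S = {U \<in> colombeau p. \<exists>u\<in>U. \<exists>\<eta>>0.
     \<forall>\<epsilon>\<in>{0<..<1}. \<epsilon> < \<eta> \<longrightarrow> u \<epsilon> \<in> S \<epsilon>}"

text \<open>The values of \<open>S\<close> off \<open>(0,1)\<close> do not affect \<^term>\<open>internal_set p S\<close>.\<close>

definition internal ::
    "('i \<Rightarrow> 'a::real_vector \<Rightarrow> real) \<Rightarrow> (real \<Rightarrow> 'a) set set \<Rightarrow> bool" where
  "internal p A \<longleftrightarrow> (\<exists>S. A = internal_set p S)"


lemma seminorm_zero: "seminorm q \<Longrightarrow> q 0 = 0"
  unfolding seminorm_def by (metis abs_zero mult_zero_left scaleR_zero_left)

lemma seminorm_minus: "seminorm q \<Longrightarrow> q (x - y) = q (y - x)"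
  unfolding seminorm_def
  by (metis abs_minus_cancel abs_one minus_diff_eq mult_1 scaleR_minus1_left)

lemma seminorm_ge_zero:
  assumes "seminorm q" shows "0 \<le> q x"
proof -
  have "q 0 \<le> q x + q (0 - x)"
    using assms unfolding seminorm_def by (metis add.right_inverse diff_0)
  then show ?thesis
    using seminorm_zero[OF assms] seminorm_minus[OF assms, of 0 x] by simp
qed

lemma seminorm_diff_triangle:
  assumes "seminorm q" shows "q (x - z) \<le> q (x - y) + q (y - z)"
  using assms unfolding seminorm_def by (metis diff_add_cancel add_diff_eq)

lemma seminorm_abs_diff:
  assumes "seminorm q" shows "\<bar>q x - q y\<bar> \<le> q (x - y)"
  using seminorm_diff_triangle[OF assms, of x 0 y] seminorm_diff_triangle[OF assms, of y 0 x]
    seminorm_minus[OF assms, of x y] by simp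

lemma equiv_colombeau_rel:
  fixes p :: "'i \<Rightarrow> 'a::real_vector \<Rightarrow> real"
  assumes p: "\<And>i. seminorm (p i)"
  shows "equiv (moderate p) (colombeau_rel p)"
proof (rule equivI)
  show "colombeau_rel p \<subseteq> moderate p \<times> moderate p"
    by (auto simp: colombeau_rel_def)
  show "refl_on (moderate p) (colombeau_rel p)"
    by (auto simp: refl_on_def colombeau_rel_def negligible_nets_def seminorm_zero[OF p]
        intro!: exI[of _ "1/2 :: real"])
  have "(v, u) \<in> colombeau_rel p" if "(u, v) \<in> colombeau_rel p" for u v
  proof -
    have "p i (v \<epsilon> - u \<epsilon>) = p i (u \<epsilon> - v \<epsilon>)" for i \<epsilon>
      by (rule seminorm_minus[OF p])
    then show ?thesis
      using that by (simp add: colombeau_rel_def negligible_nets_def)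
  qed
  then show "sym (colombeau_rel p)" by (blast intro: symI)
  show "trans (colombeau_rel p)"
  proof (rule transI)
    fix u v w assume uv: "(u, v) \<in> colombeau_rel p" and vw: "(v, w) \<in> colombeau_rel p"
    have "\<exists>\<eta>\<in>{0<..<1}. \<forall>\<epsilon>\<in>{0<..\<eta>}. p i ((\<lambda>\<epsilon>\<in>{0<..<1}. u \<epsilon> - w \<epsilon>) \<epsilon>) \<le> \<epsilon> ^ m" for i m
    proof -
      obtain a where a: "a \<in> {0<..<1}"
          "\<forall>\<epsilon>\<in>{0<..a}. p i ((\<lambda>\<epsilon>\<in>{0<..<1}. u \<epsilon> - v \<epsilon>) \<epsilon>) \<le> \<epsilon> ^ Suc m"
        using uv unfolding colombeau_rel_def negligible_nets_def by blast
      obtain b where b: "b \<in> {0<..<1}"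
          "\<forall>\<epsilon>\<in>{0<..b}. p i ((\<lambda>\<epsilon>\<in>{0<..<1}. v \<epsilon> - w \<epsilon>) \<epsilon>) \<le> \<epsilon> ^ Suc m"
        using vw unfolding colombeau_rel_def negligible_nets_def by blast
      define c where "c = min (min a b) (1/2)"
      show ?thesis
      proof (rule bexI[of _ c], rule ballI)
        show "c \<in> {0<..<1}" using a b by (auto simp: c_def)
        fix \<epsilon> assume e: "\<epsilon> \<in> {0<..c}"
        have "p i (u \<epsilon> - v \<epsilon>) \<le> \<epsilon> ^ Suc m" "p i (v \<epsilon> - w \<epsilon>) \<le> \<epsilon> ^ Suc m"
          using a(2)[rule_format, of \<epsilon>] b(2)[rule_format, of \<epsilon>] e by (auto simp: c_def)
        moreover have "2 * \<epsilon> ^ Suc m \<le> \<epsilon> ^ m"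
          using e mult_right_mono[of "2 * \<epsilon>" 1 "\<epsilon> ^ m"] by (auto simp: c_def)
        ultimately have "p i (u \<epsilon> - w \<epsilon>) \<le> \<epsilon> ^ m"
          using seminorm_diff_triangle[OF p, of i "u \<epsilon>" "w \<epsilon>" "v \<epsilon>"] by linarith
        then show "p i ((\<lambda>\<epsilon>\<in>{0<..<1}. u \<epsilon> - w \<epsilon>) \<epsilon>) \<le> \<epsilon> ^ m"
          using e by (auto simp: c_def)
      qed
    qed
    then show "(u, w) \<in> colombeau_rel p"
      using uv vw unfolding colombeau_rel_def negligible_nets_def by simp
  qed
qed

lemma seminorm_abs: "seminorm (\<lambda>x::real. \<bar>x\<bar>)"
  by (simp add: seminorm_def abs_mult abs_triangle_ineq)

lemma induced_seminorm_rel: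
  assumes p: "\<And>i. seminorm (p i)" and uv: "(u, v) \<in> colombeau_rel p"
  shows "((\<lambda>\<epsilon>\<in>{0<..<1}. p i (u \<epsilon>)), (\<lambda>\<epsilon>\<in>{0<..<1}. p i (v \<epsilon>))) \<in> colombeau_rel real_seminorms"
proof -
  have mod: "(\<lambda>\<epsilon>\<in>{0<..<1}. p i (w \<epsilon>)) \<in> moderate real_seminorms" if w: "w \<in> moderate p" for w
  proof -
    obtain M \<eta> where "\<eta> \<in> {0<..<1}" "\<forall>\<epsilon>\<in>{0<..\<eta>}. p i (w \<epsilon>) \<le> \<epsilon> powr (- real M)"
      using w unfolding moderate_def by blast
    then show ?thesis
      using seminorm_ge_zero[OF p, of i]
      by (auto simp: moderate_def intro!: exI[of _ M] bexI[of _ \<eta>])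
  qed
  have "\<exists>\<eta>\<in>{0<..<1}. \<forall>\<epsilon>\<in>{0<..\<eta>}.
      \<bar>(\<lambda>\<epsilon>\<in>{0<..<1}. (\<lambda>\<epsilon>\<in>{0<..<1}. p i (u \<epsilon>)) \<epsilon> - (\<lambda>\<epsilon>\<in>{0<..<1}. p i (v \<epsilon>)) \<epsilon>) \<epsilon>\<bar> \<le> \<epsilon> ^ m" for m
  proof -
    obtain a where a: "a \<in> {0<..<1}"
        "\<forall>\<epsilon>\<in>{0<..a}. p i ((\<lambda>\<epsilon>\<in>{0<..<1}. u \<epsilon> - v \<epsilon>) \<epsilon>) \<le> \<epsilon> ^ m"
      using uv unfolding colombeau_rel_def negligible_nets_def by blast
    show ?thesis
    proof (rule bexI[OF _ a(1)], rule ballI)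
      fix \<epsilon> assume e: "\<epsilon> \<in> {0<..a}"
      then have "p i (u \<epsilon> - v \<epsilon>) \<le> \<epsilon> ^ m" using a(1) a(2)[rule_format, OF e] by simp
      then show "\<bar>(\<lambda>\<epsilon>\<in>{0<..<1}. (\<lambda>\<epsilon>\<in>{0<..<1}. p i (u \<epsilon>)) \<epsilon> - (\<lambda>\<epsilon>\<in>{0<..<1}. p i (v \<epsilon>)) \<epsilon>) \<epsilon>\<bar> \<le> \<epsilon> ^ m"
        using seminorm_abs_diff[OF p, of i "u \<epsilon>" "v \<epsilon>"] e a(1) by simp
    qed
  qed
  then show ?thesis
    using uv mod unfolding colombeau_rel_def negligible_nets_def by simp
qed

lemma induced_seminorm_class:
  assumes p: "\<And>i. seminorm (p i)" and u: "u \<in> moderate p"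
  shows "induced_seminorm p i (colombeau_class p u) = gen_real (\<lambda>\<epsilon>\<in>{0<..<1}. p i (u \<epsilon>))"
proof -
  have "gen_real (\<lambda>\<epsilon>\<in>{0<..<1}. p i (v \<epsilon>)) = gen_real (\<lambda>\<epsilon>\<in>{0<..<1}. p i (u \<epsilon>))"
    if "v \<in> colombeau_class p u" for v
  proof -
    have "(u, v) \<in> colombeau_rel p" using that by (simp add: colombeau_class_def)
    from equiv_class_eq[OF equiv_colombeau_rel[OF seminorm_abs] induced_seminorm_rel[OF p this]]
    show ?thesis by (simp add: colombeau_class_def)
  qed
  moreover have "u \<in> colombeau_class p u"
    using equiv_class_self[OF equiv_colombeau_rel[OF p] u] by (simp add: colombeau_class_def)
  ultimately show ?thesis
    unfolding induced_seminorm_def by blast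
qed

lemma alpha_powr_in_gen_reals: "alpha_powr t \<in> gen_reals"
proof -
  obtain M :: nat where M: "- t \<le> real M" using real_arch_simple by blast
  have "\<epsilon> powr t \<le> \<epsilon> powr (- real M)" if "\<epsilon> \<in> {0<..1/2}" for \<epsilon>
    using that M by (intro powr_mono') auto
  then have "(\<lambda>\<epsilon>\<in>{0<..<1}. \<epsilon> powr t) \<in> moderate real_seminorms"
    by (auto simp: moderate_def intro!: exI[of _ M] bexI[of _ "1/2"])
  then show ?thesis
    by (simp add: alpha_powr_def colombeau_def colombeau_class_def quotientI)
qed

end

theory Submission
  imports Defs
begin

text \<open>
  The intersection point is found by a diagonal argument on representatives. Pick
  \<open>U n \<in> A n\<close> with a representative \<open>u n\<close>, and let the internal set \<open>A k\<close> be given by the net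
  \<open>S k\<close>. Since the chain decreases, \<open>U n\<close> lies in every \<open>A k\<close> with \<open>k \<le> n\<close>. Hence for small
  \<open>\<epsilon>\<close> (how small depends on \<open>n\<close>) finitely many conditions hold at once:
  for all \<open>k \<le> n\<close>, the value \<open>p k (u n \<epsilon>)\<close> is at most \<open>\<epsilon>\<close> to the power \<open>- (t k + 1)\<close>, and
  \<open>u n \<epsilon>\<close> is \<open>\<epsilon> ^ n\<close>-close, in each \<open>p j\<close> with \<open>j \<le> n\<close>, to a point of \<open>S k \<epsilon>\<close>.

  Now let \<open>n = N \<epsilon>\<close> tend to infinity as \<open>\<epsilon>\<close> tends to \<open>0\<close>, so slowly that these conditions hold
  for \<open>n = N \<epsilon>\<close> (lemma \<open>diagonal_index\<close>). The net with value \<open>u (N \<epsilon>) \<epsilon>\<close> at \<open>\<epsilon>\<close> is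
  moderate, because the growth exponent for \<open>p k\<close> is governed by \<open>t k\<close> alone and not by \<open>n\<close>: this
  is where the bounds on the sets \<open>A k\<close> enter (lemma \<open>seminorm_bound_of_le_alpha_powr\<close>). For each
  fixed \<open>k\<close> it differs by a negligible net from one with values in \<open>S k\<close>, because the accuracy
  \<open>\<epsilon> ^ N \<epsilon>\<close> beats every power of \<open>\<epsilon>\<close>. So its class belongs to every \<open>A k\<close>.
\<close>

section \<open>Asymptotic conditions as filter statements\<close>

text \<open>
  Moderateness, negligibility, the order and internality all speak of sufficiently small \<open>\<epsilon>\<close>. As
  statements about the filter \<^term>\<open>at_right (0::real)\<close> they can be combined without tracking
  the thresholds.
\<close>

lemma small_iff_eventually:
  "(\<exists>\<eta>\<in>{0<..<1}. \<forall>\<epsilon>\<in>{0<..\<eta>}. P \<epsilon>) \<longleftrightarrow> eventually P (at_right (0::real))"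
proof
  assume "\<exists>\<eta>\<in>{0<..<1}. \<forall>\<epsilon>\<in>{0<..\<eta>}. P \<epsilon>"
  then obtain \<eta> where "0 < \<eta>" "\<forall>\<epsilon>\<in>{0<..\<eta>}. P \<epsilon>" by auto
  then show "eventually P (at_right 0)"
    unfolding eventually_at_right_field by (intro exI[of _ \<eta>]) auto
next
  assume "eventually P (at_right 0)"
  then obtain b where b: "0 < b" "\<And>\<epsilon>. 0 < \<epsilon> \<Longrightarrow> \<epsilon> < b \<Longrightarrow> P \<epsilon>"
    unfolding eventually_at_right_field by auto
  then show "\<exists>\<eta>\<in>{0<..<1}. \<forall>\<epsilon>\<in>{0<..\<eta>}. P \<epsilon>"
    by (intro bexI[of _ "min (b/2) (1/2)"]) auto
qed

lemma eventually_unit_interval: "\<forall>\<^sub>F \<epsilon> in at_right (0::real). \<epsilon> \<in> {0<..<1}"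
  unfolding eventually_at_right_field by (intro exI[of _ 1]) auto

lemma moderate_iff:
  "u \<in> moderate p \<longleftrightarrow> u \<in> nets \<and>
     (\<forall>i. \<exists>M::nat. \<forall>\<^sub>F \<epsilon> in at_right 0. p i (u \<epsilon>) \<le> \<epsilon> powr (- real M))"
  by (simp add: moderate_def small_iff_eventually)

lemma colombeau_rel_iff:
  "(u, v) \<in> colombeau_rel p \<longleftrightarrow> u \<in> moderate p \<and> v \<in> moderate p \<and>
     (\<forall>i m. \<forall>\<^sub>F \<epsilon> in at_right 0. p i (u \<epsilon> - v \<epsilon>) \<le> \<epsilon> ^ m)"
proof -
  have "(\<forall>\<^sub>F \<epsilon> in at_right 0. p i ((\<lambda>\<epsilon>\<in>{0<..<1}. u \<epsilon> - v \<epsilon>) \<epsilon>) \<le> \<epsilon> ^ m) \<longleftrightarrow>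
        (\<forall>\<^sub>F \<epsilon> in at_right 0. p i (u \<epsilon> - v \<epsilon>) \<le> \<epsilon> ^ m)" for i m
    by (intro eventually_cong[OF eventually_unit_interval]) simp
  then show ?thesis
    by (simp add: colombeau_rel_def negligible_nets_def small_iff_eventually)
qed

lemma internal_set_iff:
  fixes p :: "'i \<Rightarrow> 'a::real_vector \<Rightarrow> real"
  shows "U \<in> internal_set p S \<longleftrightarrow>
     U \<in> colombeau p \<and> (\<exists>u\<in>U. \<forall>\<^sub>F \<epsilon> in at_right 0. u \<epsilon> \<in> S \<epsilon>)"
proof -
  have "(\<exists>\<eta>>0. \<forall>\<epsilon>\<in>{0<..<1}. \<epsilon> < \<eta> \<longrightarrow> u \<epsilon> \<in> S \<epsilon>) \<longleftrightarrow>
        (\<forall>\<^sub>F \<epsilon> in at_right 0. u \<epsilon> \<in> S \<epsilon>)" for u :: "real \<Rightarrow> 'a"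
  proof
    assume "\<exists>\<eta>>0. \<forall>\<epsilon>\<in>{0<..<1}. \<epsilon> < \<eta> \<longrightarrow> u \<epsilon> \<in> S \<epsilon>"
    then obtain \<eta> where "0 < \<eta>" "\<forall>\<epsilon>\<in>{0<..<1}. \<epsilon> < \<eta> \<longrightarrow> u \<epsilon> \<in> S \<epsilon>" by auto
    then show "\<forall>\<^sub>F \<epsilon> in at_right 0. u \<epsilon> \<in> S \<epsilon>"
      unfolding eventually_at_right_field by (intro exI[of _ "min \<eta> 1"]) auto
  qed (auto simp: eventually_at_right_field)
  then show ?thesis by (simp add: internal_set_def)
qed

lemma colombeau_member_rel:
  assumes p: "\<And>i. seminorm (p i)" and "U \<in> colombeau p" "u \<in> U" "v \<in> U"
  shows "(u, v) \<in> colombeau_rel p"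
proof (rule in_quotient_imp_in_rel)
  show "equiv (moderate p) (colombeau_rel p)" by (rule equiv_colombeau_rel[OF p])
  show "U \<in> moderate p // colombeau_rel p" using assms(2) by (simp add: colombeau_def)
qed (use assms(3,4) in simp)

text \<open>The accuracy needed for moderateness is only \<open>\<epsilon> ^ 0 = 1\<close>, the constant being absorbed into
  one more power of \<open>1 / \<epsilon>\<close>.\<close>

lemma moderate_perturb:
  assumes p: "\<And>i. seminorm (p i)" and u: "u \<in> moderate p" and w: "w \<in> nets"
    and uw: "\<And>i. \<forall>\<^sub>F \<epsilon> in at_right 0. p i (u \<epsilon> - w \<epsilon>) \<le> 1"
  shows "w \<in> moderate p"
  unfolding moderate_iff
proof (intro conjI allI)
  fix i
  obtain M :: nat where M: "\<forall>\<^sub>F \<epsilon> in at_right 0. p i (u \<epsilon>) \<le> \<epsilon> powr (- real M)"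
    using u unfolding moderate_iff by blast
  have small: "\<forall>\<^sub>F \<epsilon> in at_right (0::real). \<epsilon> \<in> {0<..<1/2}"
    unfolding eventually_at_right_field by (intro exI[of _ "1/2"]) auto
  have "\<forall>\<^sub>F \<epsilon> in at_right 0. p i (w \<epsilon>) \<le> \<epsilon> powr (- real (Suc M))"
    using M uw[of i] small
  proof eventually_elim
    case (elim \<epsilon>)
    have "p i (w \<epsilon>) \<le> p i (u \<epsilon>) + p i (u \<epsilon> - w \<epsilon>)"
      using seminorm_abs_diff[OF p, of i "u \<epsilon>" "w \<epsilon>"] by linarith
    moreover have "1 \<le> \<epsilon> powr (- real M)"
      using elim(3) powr_mono'[of "- real M" 0 \<epsilon>] by auto
    moreover have "\<epsilon> powr (- real (Suc M)) = \<epsilon> powr (- real M) / \<epsilon>"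
      using elim(3) powr_diff[of \<epsilon> "- real M" 1]
      by (simp only: of_nat_Suc minus_add_distrib diff_conv_add_uminus add.commute) auto
    moreover have "2 * \<epsilon> powr (- real M) \<le> \<epsilon> powr (- real M) / \<epsilon>"
      using elim(3) mult_right_mono[of "2 * \<epsilon>" 1 "\<epsilon> powr (- real M)"]
      by (auto simp: field_simps)
    ultimately show ?case using elim(1,2) by linarith
  qed
  then show "\<exists>M::nat. \<forall>\<^sub>F \<epsilon> in at_right 0. p i (w \<epsilon>) \<le> \<epsilon> powr (- real M)" by blast
qed (fact w)

section \<open>Bounds in the quotient and bounds on representatives\<close>

text \<open>
  The order on generalized reals only compares some representatives. Passing to prescribed ones
  changes both sides by at most \<open>\<epsilon>\<close>, which costs one power of \<open>1 / \<epsilon>\<close>.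
\<close>

lemma seminorm_bound_of_le_alpha_powr:
  assumes p: "\<And>i. seminorm (p i)" and U: "U \<in> colombeau p" and u: "u \<in> U" and t: "0 \<le> t"
    and le: "induced_seminorm p i U \<le>\<^sub>G alpha_powr (- t)"
  shows "\<forall>\<^sub>F \<epsilon> in at_right 0. p i (u \<epsilon>) \<le> \<epsilon> powr (- (t + 1))"
proof -
  have "u \<in> moderate p"
    using colombeau_member_rel[OF p U u u] by (simp add: colombeau_rel_iff)
  moreover have "U = colombeau_class p u"
  proof -
    obtain u0 where u0: "U = colombeau_rel p `` {u0}"
      using U unfolding colombeau_def by (rule quotientE)
    then have "(u0, u) \<in> colombeau_rel p" using u by simp
    then show ?thesis
      using u0 equiv_class_eq[OF equiv_colombeau_rel[OF p]] by (simp add: colombeau_class_def)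
  qed
  ultimately have ind: "induced_seminorm p i U = gen_real (\<lambda>\<epsilon>\<in>{0<..<1}. p i (u \<epsilon>))"
    by (simp add: induced_seminorm_class[OF p])
  obtain x y where x: "x \<in> gen_real (\<lambda>\<epsilon>\<in>{0<..<1}. p i (u \<epsilon>))"
      and y: "y \<in> gen_real (\<lambda>\<epsilon>\<in>{0<..<1}. \<epsilon> powr (- t))"
      and xy: "\<forall>\<^sub>F \<epsilon> in at_right 0. x \<epsilon> \<le> y \<epsilon>"
    using le unfolding gen_real_le_def small_iff_eventually ind alpha_powr_def by blast
  have "\<forall>\<^sub>F \<epsilon> in at_right 0. \<bar>(\<lambda>\<epsilon>\<in>{0<..<1}. p i (u \<epsilon>)) \<epsilon> - x \<epsilon>\<bar> \<le> \<epsilon> ^ 1"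
    using x unfolding colombeau_class_def Image_singleton_iff colombeau_rel_iff by blast
  moreover have "\<forall>\<^sub>F \<epsilon> in at_right 0. \<bar>(\<lambda>\<epsilon>\<in>{0<..<1}. \<epsilon> powr (- t)) \<epsilon> - y \<epsilon>\<bar> \<le> \<epsilon> ^ 1"
    using y unfolding colombeau_class_def Image_singleton_iff colombeau_rel_iff by blast
  moreover have "\<forall>\<^sub>F \<epsilon> in at_right (0::real). \<epsilon> \<in> {0<..<1/3}"
    unfolding eventually_at_right_field by (intro exI[of _ "1/3"]) auto
  ultimately show ?thesis using xy
  proof eventually_elim
    case (elim \<epsilon>)
    have "p i (u \<epsilon>) \<le> \<epsilon> powr (- t) + 2 * \<epsilon>" using elim by auto
    moreover have "1 \<le> \<epsilon> powr (- t)"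
      using elim(3) t powr_mono'[of "- t" 0 \<epsilon>] by auto
    moreover have "\<epsilon> powr (- (t + 1)) = \<epsilon> powr (- t) / \<epsilon>"
      using elim(3) powr_diff[of \<epsilon> "- t" 1] by auto
    moreover have "3 * \<epsilon> powr (- t) \<le> \<epsilon> powr (- t) / \<epsilon>"
      using elim(3) mult_right_mono[of "3 * \<epsilon>" 1 "\<epsilon> powr (- t)"] by (auto simp: field_simps)
    ultimately show ?case using elim(3) by auto
  qed
qed

section \<open>The diagonal argument\<close>

text \<open>
  Take for \<open>N \<epsilon>\<close> the largest \<open>n\<close> with both \<open>Q n \<epsilon>\<close> and \<open>n < 1 / \<epsilon>\<close>. The second condition leaves
  only finitely many candidates; since every fixed \<open>k\<close> is eventually a candidate, \<open>N\<close> tends to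
  infinity.
\<close>

lemma diagonal_index:
  fixes Q :: "nat \<Rightarrow> real \<Rightarrow> bool"
  assumes Q: "\<And>n. \<forall>\<^sub>F \<epsilon> in at_right 0. Q n \<epsilon>"
  obtains N :: "real \<Rightarrow> nat" where
    "\<And>k. \<forall>\<^sub>F \<epsilon> in at_right 0. k \<le> N \<epsilon> \<and> Q (N \<epsilon>) \<epsilon>"
proof
  define C where "C \<epsilon> = {n. Q n \<epsilon> \<and> real n < 1 / \<epsilon>}" for \<epsilon>
  show "\<forall>\<^sub>F \<epsilon> in at_right 0. k \<le> Max (C \<epsilon>) \<and> Q (Max (C \<epsilon>)) \<epsilon>" for k
  proof -
    have "\<forall>\<^sub>F \<epsilon> in at_right (0::real). \<epsilon> \<in> {0<..<1 / real (Suc k)}"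
      unfolding eventually_at_right_field by (intro exI[of _ "1 / real (Suc k)"]) auto
    then show ?thesis using Q[of k]
    proof eventually_elim
      case (elim \<epsilon>)
      have "real k * \<epsilon> < 1" using elim(1) by (auto simp: field_simps)
      then have "k \<in> C \<epsilon>" using elim by (auto simp: C_def field_simps)
      moreover have "finite (C \<epsilon>)"
      proof (rule finite_subset)
        show "C \<epsilon> \<subseteq> {..nat \<lceil>1 / \<epsilon>\<rceil>}" unfolding C_def by (auto, linarith)
      qed simp
      ultimately have "k \<le> Max (C \<epsilon>)" "Max (C \<epsilon>) \<in> C \<epsilon>" by (auto intro: Max_in)
      then show ?case by (simp add: C_def)
    qed
  qed
qed

theorem theorem3p10:
  fixes E :: "'a::real_vector topology"
    and p :: "nat \<Rightarrow> 'a \<Rightarrow> real"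
    and A :: "nat \<Rightarrow> (real \<Rightarrow> 'a) set set"
    and t :: "nat \<Rightarrow> real"
  assumes "locally_convex_generated_by E p"
    and "\<And>n x. p n x \<le> p (Suc n) x"
    and "\<And>n. internal p (A n)"
    and "\<And>n. A n \<noteq> {}"
    and "\<And>n. A (Suc n) \<subseteq> A n"
    and "\<And>n. 0 < t n"
    and "\<And>n v. v \<in> A n \<Longrightarrow> induced_seminorm p n v \<le>\<^sub>G alpha_powr (- t n)"
  shows "(\<Inter>n. A n) \<noteq> {}"
proof -
  have p: "seminorm (p i)" for i
    using assms(1) by (simp add: locally_convex_generated_by_def)
  obtain S where S: "\<And>n. A n = internal_set p (S n)"
    using assms(3) unfolding internal_def by metis
  have "\<forall>n. \<exists>V. V \<in> A n" using assms(4) by blast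
  then obtain U where U: "\<And>n. U n \<in> A n" by metis
  have UA: "U n \<in> A k" if "k \<le> n" for k n
    using U lift_Suc_antimono_le[of A, OF assms(5) that] by blast
  have Uc: "U n \<in> colombeau p" for n
    using U S by (auto simp: internal_set_iff)
  have "\<exists>w. w \<in> U n" for n
    using U[of n] unfolding S internal_set_iff by blast
  then obtain u where u: "\<And>n. u n \<in> U n" by metis
  \<comment> \<open>The representative witnessing membership in \<open>A k\<close> varies with \<open>k\<close>: no single one of \<open>U n\<close>
    need take values in all the \<open>S k\<close>.\<close>
  have "\<forall>n k. \<exists>v. k \<le> n \<longrightarrow> v \<in> U n \<and> (\<forall>\<^sub>F \<epsilon> in at_right 0. v \<epsilon> \<in> S k \<epsilon>)"
    using UA unfolding S internal_set_iff by blast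
  then obtain v where v: "\<And>n k. k \<le> n \<Longrightarrow> v n k \<in> U n"
      "\<And>n k. k \<le> n \<Longrightarrow> \<forall>\<^sub>F \<epsilon> in at_right 0. v n k \<epsilon> \<in> S k \<epsilon>"
    by metis

  define Q where "Q n \<epsilon> \<longleftrightarrow>
      (\<forall>k\<in>{..n}. p k (u n \<epsilon>) \<le> \<epsilon> powr (- (t k + 1)) \<and> v n k \<epsilon> \<in> S k \<epsilon> \<and>
        (\<forall>j\<in>{..n}. p j (u n \<epsilon> - v n k \<epsilon>) \<le> \<epsilon> ^ n))" for n \<epsilon>
  have "\<forall>\<^sub>F \<epsilon> in at_right 0. Q n \<epsilon>" for n
    unfolding Q_def
  proof (intro eventually_ball_finite ballI eventually_conj)
    fix k assume "k \<in> {..n}"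
    then have k: "k \<le> n" by simp
    show "\<forall>\<^sub>F \<epsilon> in at_right 0. p k (u n \<epsilon>) \<le> \<epsilon> powr (- (t k + 1))"
      by (rule seminorm_bound_of_le_alpha_powr[OF p Uc u _ assms(7)[OF UA[OF k]]])
        (simp add: assms(6) less_imp_le)
    show "\<forall>\<^sub>F \<epsilon> in at_right 0. v n k \<epsilon> \<in> S k \<epsilon>" by (rule v(2)[OF k])
    show "\<forall>\<^sub>F \<epsilon> in at_right 0. p j (u n \<epsilon> - v n k \<epsilon>) \<le> \<epsilon> ^ n" for j
      using colombeau_member_rel[OF p Uc u v(1)[OF k]] by (simp add: colombeau_rel_iff)
  qed auto
  then obtain N where N: "\<And>k. \<forall>\<^sub>F \<epsilon> in at_right 0. k \<le> N \<epsilon> \<and> Q (N \<epsilon>) \<epsilon>"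
    using diagonal_index by blast

  define d where "d = (\<lambda>\<epsilon>\<in>{0<..<1}. u (N \<epsilon>) \<epsilon>)"
  have "d \<in> moderate p"
    unfolding moderate_iff
  proof (intro conjI allI)
    fix i
    obtain M :: nat where M: "t i + 1 \<le> real M" using real_arch_simple by blast
    have "\<forall>\<^sub>F \<epsilon> in at_right 0. p i (d \<epsilon>) \<le> \<epsilon> powr (- real M)"
      using N[of i] eventually_unit_interval
    proof eventually_elim
      case (elim \<epsilon>)
      have "p i (d \<epsilon>) \<le> \<epsilon> powr (- (t i + 1))" using elim by (simp add: Q_def d_def)
      also have "\<dots> \<le> \<epsilon> powr (- real M)" using elim(2) M by (intro powr_mono') auto
      finally show ?case .
    qed
    then show "\<exists>M::nat. \<forall>\<^sub>F \<epsilon> in at_right 0. p i (d \<epsilon>) \<le> \<epsilon> powr (- real M)" by blast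
  qed (simp add: d_def)

  have "colombeau_class p d \<in> A k" for k
  proof -
    define w where "w = (\<lambda>\<epsilon>\<in>{0<..<1}. v (N \<epsilon>) k \<epsilon>)"
    have close: "\<forall>\<^sub>F \<epsilon> in at_right 0. p i (d \<epsilon> - w \<epsilon>) \<le> \<epsilon> ^ m" for i m
      \<comment> \<open>As soon as \<open>N \<epsilon>\<close> exceeds \<open>i\<close>, \<open>k\<close> and \<open>m\<close>.\<close>
      using N[of "max i (max k m)"] eventually_unit_interval
    proof eventually_elim
      case (elim \<epsilon>)
      have "p i (d \<epsilon> - w \<epsilon>) \<le> \<epsilon> ^ N \<epsilon>" using elim by (simp add: Q_def d_def w_def)
      also have "\<dots> \<le> \<epsilon> ^ m" using elim by (intro power_decreasing) auto
      finally show ?case .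
    qed
    have "w \<in> moderate p"
      using moderate_perturb[OF p \<open>d \<in> moderate p\<close>, of w] close[of _ 0] by (simp add: w_def)
    then have "w \<in> colombeau_class p d"
      using \<open>d \<in> moderate p\<close> close by (simp add: colombeau_class_def colombeau_rel_iff)
    moreover have "\<forall>\<^sub>F \<epsilon> in at_right 0. w \<epsilon> \<in> S k \<epsilon>"
      using N[of k] eventually_unit_interval
      by eventually_elim (simp add: Q_def w_def)
    moreover have "colombeau_class p d \<in> colombeau p"
      using \<open>d \<in> moderate p\<close> by (simp add: colombeau_def colombeau_class_def quotientI)
    ultimately show ?thesis by (auto simp: S internal_set_iff)
  qed
  then show ?thesis by blast
qed

end
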